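(* Let $n \ge m\ge 1$ be integers. Let $\Delta_{m,n}$ be the $m\times n$ chessboard complex and $\mathcal{F}(\Delta_{m,n})$ its facet ideal. Then \[ \mathrm{v}(\mathcal{F}(\Delta_{m,n}))=2m-2. \]
   Context: Let $\mathbb{K}$ be a field and $S=\mathbb{K}[x_{i,j}\mid 1\le i\le m,\ 1\le j\le n]$ the standard graded polynomial ring, $S_d$ its degree $d$ component. The variable $x_{i,j}$ is identified with the square in row $i$ and column $j$ of an $m\times n$ chessboard. Chessboard complex: $\Delta_{m,n}$ is the simplicial complex on the vertex set $V=\{x_{i,j}\mid 1\le i\le m,\ 1\le j\le n\}$ whose faces are the subsets of $V$ with no two squares in the same row or the same column. A facet is a face maximal with respect to inclusion. Facet ideal: for $F\subseteq V$ put $\mathbf{x}_F=\prod_{x\in F}x$. Then $\mathcal{F}(\Delta_{m,n})=(\mathbf{x}_F\mid F \text{ a facet of } \Delta_{m,n})\subseteq S$; explicitly (as $n\ge m$), $\mathcal{F}(\Delta_{m,n})=(x_{1,\ell_1}\cdots x_{m,\ell_m}\mid 1\le \ell_1,\dots,\ell_m\le n \text{ pairwise distinct})$. $\mathrm{v}$-number: for a graded ideal $I\subseteq S$, let $\operatorname{Ass}(I)$ be the set of associated primes of $I$ (i.e. of $S/I$). For $\mathfrak{p}\in\operatorname{Ass}(I)$ let $\mathrm{v}_{\mathfrak{p}}(I)=\min\{d\ge 0\mid \text{there exists } f\in S_d \text{ with } (I:f)=\mathfrak{p}\}$, and let $\mathrm{v}(I)=\min\{\mathrm{v}_{\mathfrak{p}}(I)\mid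 \mathfrak{p}\in\operatorname{Ass}(I)\}$. *)

theory Defs
  imports "HOL-Algebra.Ideal" "HOL-Library.Poly_Mapping" "HOL-Library.Extended_Nat"
begin

section \<open>Polynomial rings\<close>

text \<open>A monomial is its finitely supported exponent vector, and a polynomial is a finitely
  supported map from monomials to coefficients; multiplication on this type is convolution.\<close>

type_synonym 'v monomial = "'v \<Rightarrow>\<^sub>0 nat"
type_synonym ('v, 'k) mpoly = "'v monomial \<Rightarrow>\<^sub>0 'k"

definition Var :: "'v \<Rightarrow> ('v, 'k::field) mpoly"
  where "Var x = Poly_Mapping.single (Poly_Mapping.single x 1) 1"

text \<open>The ring \<open>K[x | x \<in> V]\<close>, where the field \<open>K\<close> is the type \<open>'k\<close>: the polynomials all of
  whose monomials are supported in \<open>V\<close>.\<close>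

definition poly_ring :: "'v set \<Rightarrow> ('v, 'k::field) mpoly ring"
  where "poly_ring V =
    \<lparr>carrier = {p. \<forall>u\<in>Poly_Mapping.keys p. Poly_Mapping.keys u \<subseteq> V},
     mult = (*), one = 1, zero = 0, add = (+)\<rparr>"

definition mdegree :: "'v monomial \<Rightarrow> nat"
  where "mdegree u = (\<Sum>x\<in>Poly_Mapping.keys u. Poly_Mapping.lookup u x)"

definition homogeneous_component :: "'v set \<Rightarrow> nat \<Rightarrow> ('v, 'k::field) mpoly set"
  where "homogeneous_component V d =
    {p \<in> carrier (poly_ring V). \<forall>u\<in>Poly_Mapping.keys p. mdegree u = d}"


section \<open>Associated primes and the v-number\<close>

definition colon :: "('a, 'b) ring_scheme \<Rightarrow> 'a set \<Rightarrow> 'a \<Rightarrow> 'a set"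
  where "colon R I f = {g \<in> carrier R. g \<otimes>\<^bsub>R\<^esub> f \<in> I}"

definition Ass :: "('a, 'b) ring_scheme \<Rightarrow> 'a set \<Rightarrow> 'a set set"
  where "Ass R I = {P. primeideal P R \<and> (\<exists>f\<in>carrier R. colon R I f = P)}"

text \<open>The minima are taken in \<^typ>\<open>enat\<close>, where a nonempty set attains its infimum and the infimum
  of the empty set is \<open>\<infinity>\<close>. A finite value therefore says that the minimum exists.\<close>

definition v_local :: "'v set \<Rightarrow> ('v, 'k::field) mpoly set \<Rightarrow> ('v, 'k) mpoly set \<Rightarrow> enat"
  where "v_local V I P =
    Inf {enat d | d. \<exists>f\<in>homogeneous_component V d. colon (poly_ring V) I f = P}"

definition v_number :: "'v set \<Rightarrow> ('v, 'k::field) mpoly set \<Rightarrow> enat"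
  where "v_number V I = (INF P\<in>Ass (poly_ring V) I. v_local V I P)"


section \<open>Facet ideals and chessboard complexes\<close>

definition facets :: "'v set set \<Rightarrow> 'v set set"
  where "facets \<Delta> = {F \<in> \<Delta>. \<forall>G\<in>\<Delta>. F \<subseteq> G \<longrightarrow> G = F}"

definition facet_ideal :: "'v set \<Rightarrow> 'v set set \<Rightarrow> ('v, 'k::field) mpoly set"
  where "facet_ideal V \<Delta> = Idl\<^bsub>poly_ring V\<^esub> {(\<Prod>x\<in>F. Var x) | F. F \<in> facets \<Delta>}"

definition squares :: "nat \<Rightarrow> nat \<Rightarrow> (nat \<times> nat) set"
  where "squares m n = {1..m} \<times> {1..n}"

definition chessboard_complex :: "nat \<Rightarrow> nat \<Rightarrow> (nat \<times> nat) set set"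
  where "chessboard_complex m n =
    {F. F \<subseteq> squares m n \<and>
        (\<forall>x\<in>F. \<forall>y\<in>F. x \<noteq> y \<longrightarrow> fst x \<noteq> fst y \<and> snd x \<noteq> snd y)}"


section \<open>Basic facts\<close>

lemma cring_poly_ring: "cring (poly_ring V :: ('v, 'k::field) mpoly ring)"
proof (rule cringI)
  let ?R = "poly_ring V :: ('v, 'k) mpoly ring"
  show "abelian_group ?R"
  proof (rule abelian_groupI)
    fix p q assume "p \<in> carrier ?R" "q \<in> carrier ?R"
    then show "p \<oplus>\<^bsub>?R\<^esub> q \<in> carrier ?R"
      using Poly_Mapping.keys_add[of p q] by (auto simp: poly_ring_def)
  next
    fix p assume "p \<in> carrier ?R"
    then show "\<exists>q\<in>carrier ?R. q \<oplus>\<^bsub>?R\<^esub> p = \<zero>\<^bsub>?R\<^esub>"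
      by (intro bexI[of _ "- p"]) (auto simp: poly_ring_def)
  qed (auto simp: poly_ring_def add_ac)
  show "Group.comm_monoid ?R"
  proof (rule comm_monoidI)
    fix p q assume p: "p \<in> carrier ?R" and q: "q \<in> carrier ?R"
    have "Poly_Mapping.keys w \<subseteq> V" if "w \<in> Poly_Mapping.keys (p * q)" for w
    proof -
      from that Poly_Mapping.keys_mult[of p q] obtain a b
        where "w = a + b" "a \<in> Poly_Mapping.keys p" "b \<in> Poly_Mapping.keys q"
        by blast
      then show ?thesis
        using p q Poly_Mapping.keys_add[of a b] by (fastforce simp: poly_ring_def)
    qed
    then show "p \<otimes>\<^bsub>?R\<^esub> q \<in> carrier ?R"
      by (simp add: poly_ring_def)
  qed (auto simp: poly_ring_def mult_ac)
qed (auto simp: poly_ring_def algebra_simps)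

lemma Var_in_carrier: "x \<in> V \<Longrightarrow> Var x \<in> carrier (poly_ring V)"
  by (auto simp: Var_def poly_ring_def)

end

theory Submission
  imports Defs "HOL-Library.Product_Lexorder"
begin

text \<open>
  A monomial \<open>x\<^sup>u\<close> lies in the facet ideal \<open>I\<close> exactly when its support contains a placement of \<open>m\<close>
  rooks, one in each row and no two in the same column. Both bounds on the v-number are therefore
  statements about sets of squares.

  Lower bound. Let \<open>P = (I : f)\<close> be prime with \<open>f\<close> homogeneous of degree \<open>d\<close>. Pick a monomial \<open>x\<^sup>u\<close> of
  \<open>f\<close> outside \<open>I\<close> and let \<open>T\<close> be its support and \<open>C\<close> the set of the squares whose variables lie in \<open>P\<close>.
  Then \<open>T\<close> contains no placement. Adding any square \<open>v \<in> C\<close> creates one, because \<open>x\<^sub>v f \<in> I\<close>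
  and \<open>I\<close> is a monomial ideal. Every placement meets \<open>C\<close>, because \<open>P\<close> is a prime containing \<open>I\<close>. By
  Hall's theorem \<open>C\<close> then contains a block \<open>A \<times> (L - N)\<close>, where \<open>A\<close> is a set of rows, \<open>L\<close> is the set of
  all columns and \<open>|N| < |A|\<close>. The placement created by adding a square \<open>(i, j)\<close> of this block must
  match the rows \<open>A - {i}\<close> with the columns \<open>N\<close> and send the rows outside \<open>A\<close> to columns outside
  \<open>N\<close> other than \<open>j\<close>. Since \<open>i\<close> and \<open>j\<close> are arbitrary, each of the \<open>|A| - 1\<close> columns in \<open>N\<close> has two
  squares of \<open>T\<close> in the rows \<open>A\<close>, and each of the \<open>m - |A|\<close> other rows has two squares of \<open>T\<close> outside the
  columns \<open>N\<close>. These squares are all different, so \<open>d \<ge> |T| \<ge> 2m - 2\<close>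
  (\<open>critical_set_card\<close>, \<open>chessboard_prime_colon_degree_ge\<close>).

  Upper bound. Let \<open>T\<close> be the staircase of the squares \<open>(i, i - 1)\<close> and \<open>(i, i)\<close> for \<open>2 \<le> i \<le> m\<close>. It
  leaves the first row empty, and the rows below the first can be placed on it so as to avoid any
  prescribed column. Hence \<open>(I : x\<^sub>T)\<close> is the prime generated by the variables of the first row, and
  \<open>x\<^sub>T\<close> has degree \<open>2m - 2\<close> (\<open>chessboard_colon_first_row\<close>).
\<close>

section \<open>Systems of distinct representatives\<close>

text \<open>Rado's proof: as long as some \<open>S k\<close> has two elements \<open>x \<noteq> y\<close>, one of them can be removed without
  violating the cardinality condition. Otherwise there are sets \<open>J\<close> and \<open>K\<close> of indices violating it
  after the removal of \<open>x\<close> and of \<open>y\<close>, and the inclusion-exclusion formula for the two unions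
  contradicts the condition for \<open>J \<union> K \<union> {k}\<close> and \<open>J \<inter> K\<close>.\<close>

theorem hall_marriage:
  fixes S :: "'a \<Rightarrow> 'b set"
  assumes "finite I" and "\<And>i. i \<in> I \<Longrightarrow> finite (S i)"
    and "\<And>J. J \<subseteq> I \<Longrightarrow> card J \<le> card (\<Union>i\<in>J. S i)"
  shows "\<exists>\<sigma>. inj_on \<sigma> I \<and> (\<forall>i\<in>I. \<sigma> i \<in> S i)"
  using assms
proof (induction "\<Sum>i\<in>I. card (S i)" arbitrary: S rule: less_induct)
  case less
  note fin = less.prems(1,2) and hall = less.prems(3)
  show ?case
  proof (cases "\<forall>i\<in>I. card (S i) = 1")
    case True
    then have "\<forall>i\<in>I. \<exists>x. S i = {x}"
      by (auto simp: card_1_singleton_iff)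
    then obtain \<sigma> where \<sigma>: "\<And>i. i \<in> I \<Longrightarrow> S i = {\<sigma> i}"
      by (auto dest: bchoice)
    have "i = j" if "i \<in> I" "j \<in> I" "\<sigma> i = \<sigma> j" for i j
    proof (rule ccontr)
      assume "i \<noteq> j"
      moreover have "(\<Union>l\<in>{i, j}. S l) = {\<sigma> i}"
        using \<sigma>[OF that(1)] \<sigma>[OF that(2)] that(3) by simp
      ultimately show False
        using hall[of "{i, j}"] that(1,2) by simp
    qed
    then have "inj_on \<sigma> I" by (rule inj_onI)
    with \<sigma> show ?thesis by blast
  next
    case False
    then obtain k where k: "k \<in> I" "card (S k) \<noteq> 1" by blast
    moreover from k hall[of "{k}"] have "1 \<le> card (S k)" by simp
    ultimately have "2 \<le> card (S k)" by linarith
    then obtain x y where xy: "x \<in> S k" "y \<in> S k" "x \<noteq> y"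
      using card_le_Suc0_iff_eq[OF fin(2)[OF k(1)]] by auto
    have dichotomy: "(\<exists>\<sigma>. inj_on \<sigma> I \<and> (\<forall>i\<in>I. \<sigma> i \<in> S i)) \<or>
       (\<exists>J. J \<subseteq> I - {k} \<and> card ((\<Union>i\<in>J. S i) \<union> (S k - {z})) \<le> card J)"
      if z: "z \<in> S k" for z
    proof (cases "\<exists>J. J \<subseteq> I - {k} \<and> card ((\<Union>i\<in>J. S i) \<union> (S k - {z})) \<le> card J")
      case noJ: False
      define S' where "S' = S(k := S k - {z})"
      have S'_sub: "S' i \<subseteq> S i" for i by (auto simp: S'_def)
      have "(\<Sum>i\<in>I. card (S' i)) < (\<Sum>i\<in>I. card (S i))"
      proof (rule sum_strict_mono_ex1)
        show "\<forall>i\<in>I. card (S' i) \<le> card (S i)"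
          using fin(2) S'_sub by (auto intro: card_mono)
        have "card (S k - {z}) < card (S k)"
          using fin(2)[OF k(1)] z by (rule card_Diff1_less)
        with k(1) show "\<exists>i\<in>I. card (S' i) < card (S i)"
          by (auto simp: S'_def)
      qed (use fin in auto)
      moreover have "finite (S' i)" if "i \<in> I" for i
        using S'_sub fin(2)[OF that] finite_subset by blast
      moreover have "card J \<le> card (\<Union>i\<in>J. S' i)" if J: "J \<subseteq> I" for J
      proof (cases "k \<in> J")
        case True
        have "(\<Union>i\<in>J. S' i) = (\<Union>i\<in>J - {k}. S i) \<union> (S k - {z})"
          using True by (auto simp: S'_def)
        moreover have "card (J - {k}) < card ((\<Union>i\<in>J - {k}. S i) \<union> (S k - {z}))"
        proof -
          have "J - {k} \<subseteq> I - {k}" using J by blast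
          with noJ show ?thesis by (meson not_le)
        qed
        moreover have "card (J - {k}) = card J - 1"
          using True by simp
        ultimately show ?thesis by simp
      next
        case False
        then have "(\<Union>i\<in>J. S' i) = (\<Union>i\<in>J. S i)" by (auto simp: S'_def)
        with hall[OF J] show ?thesis by simp
      qed
      ultimately obtain \<sigma> where "inj_on \<sigma> I" "\<forall>i\<in>I. \<sigma> i \<in> S' i"
        using less.hyps[of S'] fin(1) by blast
      then show ?thesis using S'_sub by blast
    qed blast
    show ?thesis
    proof (rule ccontr)
      assume no: "\<not> ?thesis"
      obtain J where J: "J \<subseteq> I - {k}" "card ((\<Union>i\<in>J. S i) \<union> (S k - {x})) \<le> card J"
        using dichotomy[OF xy(1)] no by blast
      obtain K where K: "K \<subseteq> I - {k}" "card ((\<Union>i\<in>K. S i) \<union> (S k - {y})) \<le> card K"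
        using dichotomy[OF xy(2)] no by blast
      define P where "P = (\<Union>i\<in>J. S i) \<union> (S k - {x})"
      define Q where "Q = (\<Union>i\<in>K. S i) \<union> (S k - {y})"
      have finJK: "finite J" "finite K" using J K fin(1) finite_subset by blast+
      have finPQ: "finite P" "finite Q"
        using J K k fin finJK by (auto simp: P_def Q_def)
      have un: "P \<union> Q = (\<Union>i\<in>insert k (J \<union> K). S i)"
        using xy by (auto simp: P_def Q_def)
      have int: "(\<Union>i\<in>J \<inter> K. S i) \<subseteq> P \<inter> Q"
        by (auto simp: P_def Q_def)
      have "card (insert k (J \<union> K)) \<le> card (P \<union> Q)"
        unfolding un using J K k by (intro hall) auto
      moreover have "card (insert k (J \<union> K)) = card (J \<union> K) + 1"
        using J K finJK by (subst card_insert_disjoint) auto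
      moreover have "card (J \<inter> K) \<le> card (P \<inter> Q)"
      proof -
        have "card (J \<inter> K) \<le> card (\<Union>i\<in>J \<inter> K. S i)"
          using J(1) by (intro hall) blast
        also have "\<dots> \<le> card (P \<inter> Q)"
          using finPQ int by (intro card_mono) simp_all
        finally show ?thesis .
      qed
      moreover have "card P + card Q = card (P \<union> Q) + card (P \<inter> Q)"
        using finPQ by (rule card_Un_Int)
      moreover have "card J + card K = card (J \<union> K) + card (J \<inter> K)"
        using finJK by (rule card_Un_Int)
      ultimately show False using J(2) K(2) unfolding P_def[symmetric] Q_def[symmetric] by linarith
    qed
  qed
qed


section \<open>Rook placements\<close>

text \<open>The relevant placements occupy every row of \<open>R\<close>, so they are the graphs of the injections on \<open>R\<close>.\<close>

definition has_placement :: "'a set \<Rightarrow> ('a \<times> 'b) set \<Rightarrow> bool"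
  where "has_placement R T \<longleftrightarrow> (\<exists>\<sigma>. inj_on \<sigma> R \<and> (\<forall>i\<in>R. (i, \<sigma> i) \<in> T))"

lemma has_placement_mono: "has_placement R T \<Longrightarrow> T \<subseteq> T' \<Longrightarrow> has_placement R T'"
  by (auto simp: has_placement_def)

text \<open>This is Hall's theorem applied to the complement of \<open>C\<close>: a set \<open>A\<close> of rows violating
  the cardinality condition has too few columns \<open>N\<close> available, and in all other columns
  the rows of \<open>A\<close> lie in \<open>C\<close>.\<close>

lemma blocking_set_contains_block:
  assumes "finite R" "finite L" and "\<not> has_placement R (R \<times> L - C)"
  obtains A N where "A \<subseteq> R" "N \<subseteq> L" "card N < card A" "A \<times> (L - N) \<subseteq> C"
proof -
  define S where "S i = {j \<in> L. (i, j) \<notin> C}" for i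
  have "\<not> (\<exists>\<sigma>. inj_on \<sigma> R \<and> (\<forall>i\<in>R. \<sigma> i \<in> S i))"
    using assms(3) by (auto simp: has_placement_def S_def)
  then obtain A where A: "A \<subseteq> R" "\<not> card A \<le> card (\<Union>i\<in>A. S i)"
    using hall_marriage[of R S] assms(1,2) unfolding S_def by fastforce
  show thesis
  proof (rule that)
    show "A \<times> (L - (\<Union>i\<in>A. S i)) \<subseteq> C" by (auto simp: S_def)
  qed (use A in \<open>auto simp: S_def\<close>)
qed

lemma card_Sigma_ge:
  assumes "finite I" and "\<And>i. i \<in> I \<Longrightarrow> finite (S i)" and "\<And>i. i \<in> I \<Longrightarrow> k \<le> card (S i)"
  shows "k * card I \<le> card (Sigma I S)"
proof -
  have "k * card I = (\<Sum>i\<in>I. k)" by simp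
  also have "\<dots> \<le> (\<Sum>i\<in>I. card (S i))" by (rule sum_mono) (rule assms(3))
  also have "\<dots> = card (Sigma I S)" using assms by simp
  finally show ?thesis .
qed

lemma two_le_cardI: "finite S \<Longrightarrow> x \<in> S \<Longrightarrow> y \<in> S \<Longrightarrow> x \<noteq> y \<Longrightarrow> 2 \<le> card S"
  using card_mono[of S "{x, y}"] by simp

text \<open>The combinatorial core of the lower bound. In the application \<open>T\<close> is the support of a monomial
  and \<open>C\<close> is the set of variables in its colon prime. The bound holds because \<open>C\<close> contains a block
  \<open>A \<times> (L - N)\<close> with \<open>|N| < |A|\<close>, and the placements created by its various squares need two squares
  of \<open>T\<close> in each column of \<open>N\<close> and in each row outside \<open>A\<close>.\<close>

lemma critical_set_card:
  fixes T C :: "('a \<times> 'b) set"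
  assumes fin: "finite R" "finite L" and le: "card R \<le> card L"
    and T: "T \<subseteq> R \<times> L" "\<not> has_placement R T"
    and C: "\<And>v. v \<in> C \<Longrightarrow> has_placement R (insert v T)"
    and blocking: "\<not> has_placement R (R \<times> L - C)"
  shows "2 * card R \<le> card T + 2"
proof -
  obtain A N where A: "A \<subseteq> R" and N: "N \<subseteq> L" "card N < card A" and block: "A \<times> (L - N) \<subseteq> C"
    using blocking_set_contains_block[OF fin blocking] .
  have finA: "finite A" and finN: "finite N" and finT: "finite T"
    using A N T fin finite_subset by blast+
  have TC: "v \<notin> C" if "v \<in> T" for v
    using C[of v] T(2) that by (auto simp: insert_absorb)
  have cardA: "card A \<le> card R" using A fin card_mono by blast
  have "\<not> L \<subseteq> N"
    using N(2) le cardA card_mono[OF finN, of L] by linarith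
  then obtain j0 where j0: "j0 \<in> L - N" by blast
  \<comment> \<open>The set \<open>T\<close> avoids the block, so the \<open>|A| - 1\<close> rows of \<open>A\<close> other than \<open>i\<close> must be placed in the
    fewer than \<open>|A|\<close> columns \<open>N\<close>. They fill \<open>N\<close> completely and drive the rows outside \<open>A\<close> out of it.\<close>
  have matching: "\<exists>\<sigma>. inj_on \<sigma> R \<and> \<sigma> i = j \<and> (\<forall>r\<in>R - {i}. (r, \<sigma> r) \<in> T) \<and>
      \<sigma> ` (A - {i}) = N \<and> card N = card A - 1 \<and> \<sigma> ` (R - A) \<subseteq> L - N - {j}"
    if i: "i \<in> A" and j: "j \<in> L - N" for i j
  proof -
    have "has_placement R (insert (i, j) T)" using C block i j by blast
    then obtain \<sigma> where inj: "inj_on \<sigma> R" and \<sigma>: "\<And>r. r \<in> R \<Longrightarrow> (r, \<sigma> r) \<in> insert (i, j) T"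
      by (auto simp: has_placement_def)
    \<comment> \<open>A placement that does not use the new square would already lie in \<open>T\<close>.\<close>
    have ij: "\<sigma> i = j"
    proof (rule ccontr)
      assume "\<sigma> i \<noteq> j"
      then have "\<forall>r\<in>R. (r, \<sigma> r) \<in> T" using \<sigma> by auto
      with inj T(2) show False by (auto simp: has_placement_def)
    qed
    have inT: "(r, \<sigma> r) \<in> T" if "r \<in> R - {i}" for r using \<sigma>[of r] that by auto
    have into: "\<sigma> ` (A - {i}) \<subseteq> N"
    proof
      fix c assume "c \<in> \<sigma> ` (A - {i})"
      then obtain r where r: "r \<in> A - {i}" "c = \<sigma> r" by blast
      with inT[of r] A have "(r, c) \<in> T" by blast
      with TC[of "(r, c)"] T(1) block r show "c \<in> N" by blast
    qed
    have injA: "inj_on \<sigma> (A - {i})" using inj A by (auto intro: inj_on_subset)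
    have card: "card (\<sigma> ` (A - {i})) = card A - 1"
      using card_image[OF injA] i finA by simp
    have onto: "\<sigma> ` (A - {i}) = N"
      using card_subset_eq[OF finN into] card_mono[OF finN into] card N(2) by linarith
    have "\<sigma> r \<in> L - N - {j}" if r: "r \<in> R - A" for r
    proof -
      have "\<sigma> r \<notin> \<sigma> ` A" using inj A r by (auto simp: inj_on_def)
      moreover have "N \<subseteq> \<sigma> ` A" "j \<in> \<sigma> ` A" using onto ij i by blast+
      moreover have "\<sigma> r \<in> L" using inT[of r] r i T(1) by blast
      ultimately show ?thesis by auto
    qed
    then have "\<sigma> ` (R - A) \<subseteq> L - N - {j}" by blast
    with inj ij inT onto card show ?thesis
      by (intro exI[of _ \<sigma>]) simp
  qed
  obtain i0 where i0: "i0 \<in> A" using N(2) by (cases "A = {}") auto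
  have cardN: "card N = card A - 1" using matching[OF i0 j0] by blast
  have cols: "2 \<le> card {r \<in> A. (r, c) \<in> T}" if c: "c \<in> N" for c
  proof -
    have other: "\<exists>r\<in>A - {i}. (r, c) \<in> T" if i: "i \<in> A" for i
    proof -
      obtain \<sigma> where \<sigma>: "\<forall>r\<in>R - {i}. (r, \<sigma> r) \<in> T" "\<sigma> ` (A - {i}) = N"
        using matching[OF i j0] by blast
      from c \<sigma>(2) obtain r where "r \<in> A - {i}" "c = \<sigma> r" by blast
      with \<sigma>(1) A show ?thesis by blast
    qed
    \<comment> \<open>A first square of the column is found by leaving out row \<open>i0\<close>, a second one by leaving out
      the row of the first.\<close>
    obtain r1 where r1: "r1 \<in> A" "(r1, c) \<in> T" using other[OF i0] by blast
    obtain r2 where "r2 \<in> A - {r1}" "(r2, c) \<in> T" using other[OF r1(1)] by blast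
    then show ?thesis using r1 finA by (intro two_le_cardI[of _ r1 r2]) auto
  qed
  have rows: "2 \<le> card {c \<in> L - N. (r, c) \<in> T}" if r: "r \<in> R - A" for r
  proof -
    have other: "\<exists>c\<in>L - N - {j}. (r, c) \<in> T" if j: "j \<in> L - N" for j
    proof -
      obtain \<sigma> where "\<forall>r\<in>R - {i0}. (r, \<sigma> r) \<in> T" "\<sigma> ` (R - A) \<subseteq> L - N - {j}"
        using matching[OF i0 j] by blast
      then show ?thesis using r i0 by blast
    qed
    \<comment> \<open>Likewise, with the column of the first square forbidden for the second.\<close>
    obtain c1 where c1: "c1 \<in> L - N" "(r, c1) \<in> T" using other[OF j0] by blast
    obtain c2 where "c2 \<in> L - N - {c1}" "(r, c2) \<in> T" using other[OF c1(1)] by blast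
    then show ?thesis using c1 fin(2) by (intro two_le_cardI[of _ c1 c2]) auto
  qed
  let ?X = "SIGMA c:N. {r \<in> A. (r, c) \<in> T}" and ?Y = "SIGMA r:R - A. {c \<in> L - N. (r, c) \<in> T}"
  have "2 * card N + 2 * card (R - A) \<le> card ?X + card ?Y"
    using finN finA fin cols rows by (intro add_mono card_Sigma_ge) auto
  also have "\<dots> = card (prod.swap ` ?X) + card ?Y"
    by (simp add: card_image)
  also have "\<dots> = card (prod.swap ` ?X \<union> ?Y)"
    using finN finA fin by (intro card_Un_disjoint[symmetric]) (auto intro!: finite_SigmaI)
  also have "\<dots> \<le> card T"
    by (rule card_mono[OF finT]) auto
  finally show ?thesis
    using cardN N(2) cardA A finA by (simp add: card_Diff_subset)
qed


section \<open>Monomial ideals determined by supports\<close>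

lemma keys_add_monomial:
  "Poly_Mapping.keys (u + v :: 'v monomial) = Poly_Mapping.keys u \<union> Poly_Mapping.keys v"
  by (auto simp: in_keys_iff lookup_add)

text \<open>Multiplication by a monomial translates the exponent vectors, so nothing cancels. This is what makes
  colons by monomials, and products with single variables, computable on supports.\<close>

lemma keys_times_monomial:
  fixes p :: "('v, 'k::field) mpoly"
  assumes "c \<noteq> 0"
  shows "Poly_Mapping.keys (Poly_Mapping.single s c * p) = (+) s ` Poly_Mapping.keys p"
proof -
  have look: "Poly_Mapping.lookup (Poly_Mapping.single s c * p) (s + u) = c * Poly_Mapping.lookup p u" for u
    by (simp add: lookup_mult lookup_single when_mult)
  show ?thesis
  proof
    show "Poly_Mapping.keys (Poly_Mapping.single s c * p) \<subseteq> (+) s ` Poly_Mapping.keys p"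
      using keys_mult[of "Poly_Mapping.single s c" p] by (auto split: if_splits)
    show "(+) s ` Poly_Mapping.keys p \<subseteq> Poly_Mapping.keys (Poly_Mapping.single s c * p)"
      using look assms by (auto simp: in_keys_iff)
  qed
qed

lemma sum_monomials:
  fixes p :: "('v, 'k::field) mpoly"
  shows "(\<Sum>u\<in>Poly_Mapping.keys p. Poly_Mapping.single u (Poly_Mapping.lookup p u)) = p"
  by (rule poly_mapping_eqI)
     (auto simp: lookup_sum lookup_single when_def in_keys_iff)

text \<open>Membership in an ideal generated by squarefree monomials depends only on the supports of the
  monomials of a polynomial. Describing such an ideal by an upward closed property \<open>U\<close> of supports
  covers both the facet ideals and the primes generated by variables. Upward closure is the
  assumption \<open>mono U\<close> of the lemmas below.\<close>

definition support_ideal :: "'v set \<Rightarrow> ('v set \<Rightarrow> bool) \<Rightarrow> ('v, 'k::field) mpoly set"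
  where "support_ideal V U =
    {p \<in> carrier (poly_ring V). \<forall>u\<in>Poly_Mapping.keys p. U (Poly_Mapping.keys u)}"

lemma support_ideal_add: "p \<in> support_ideal V U \<Longrightarrow> q \<in> support_ideal V U \<Longrightarrow> p + q \<in> support_ideal V U"
  using keys_add[of p q] unfolding support_ideal_def poly_ring_def by fastforce

lemma support_ideal_uminus: "p \<in> support_ideal V U \<Longrightarrow> - p \<in> support_ideal V U"
  by (simp add: support_ideal_def poly_ring_def)

lemma poly_ring_ops:
  "p \<otimes>\<^bsub>poly_ring V\<^esub> q = p * q" "p \<oplus>\<^bsub>poly_ring V\<^esub> q = p + q"
  "\<one>\<^bsub>poly_ring V\<^esub> = 1" "\<zero>\<^bsub>poly_ring V\<^esub> = 0"
  by (simp_all add: poly_ring_def)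

lemma times_in_carrier:
  fixes p q :: "('v, 'k::field) mpoly"
  assumes "p \<in> carrier (poly_ring V)" "q \<in> carrier (poly_ring V)"
  shows "p * q \<in> carrier (poly_ring V)"
proof -
  interpret cring "poly_ring V :: ('v, 'k) mpoly ring" by (rule cring_poly_ring)
  have "p \<otimes>\<^bsub>poly_ring V\<^esub> q \<in> carrier (poly_ring V)" using assms by (rule m_closed)
  then show ?thesis by (simp only: poly_ring_ops)
qed

lemma support_ideal_times:
  assumes "mono U" "p \<in> support_ideal V U" "q \<in> carrier (poly_ring V)"
  shows "p * q \<in> support_ideal V U"
proof -
  have "p * q \<in> carrier (poly_ring V)"
    using assms(2,3) unfolding support_ideal_def by (blast intro: times_in_carrier)
  moreover have "U (Poly_Mapping.keys w)" if "w \<in> Poly_Mapping.keys (p * q)" for w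
  proof -
    from that keys_mult[of p q] obtain u v
      where "w = u + v" "u \<in> Poly_Mapping.keys p" by blast
    then show ?thesis
    proof -
      have "U (Poly_Mapping.keys u)"
        using assms(2) \<open>u \<in> Poly_Mapping.keys p\<close> by (simp add: support_ideal_def)
      moreover have "U (Poly_Mapping.keys u) \<le> U (Poly_Mapping.keys w)"
        using assms(1) by (rule monoD) (simp add: \<open>w = u + v\<close> keys_add_monomial)
      ultimately show ?thesis by simp
    qed
  qed
  ultimately show ?thesis by (simp add: support_ideal_def)
qed

lemma ideal_support_ideal:
  fixes V :: "'v set"
  assumes "mono U"
  shows "ideal (support_ideal V U :: ('v, 'k::field) mpoly set) (poly_ring V)"
proof -
  let ?R = "poly_ring V :: ('v, 'k) mpoly ring"
  interpret cring ?R by (rule cring_poly_ring)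
  show ?thesis
  proof (rule idealI[OF ring_axioms])
    show "subgroup (support_ideal V U) (add_monoid ?R)"
    proof (rule add.subgroupI)
      show "support_ideal V U \<subseteq> carrier ?R" by (auto simp: support_ideal_def)
      have "0 \<in> support_ideal V U" by (simp add: support_ideal_def poly_ring_def)
      then show "support_ideal V U \<noteq> {}" by blast
    next
      fix p :: "('v, 'k) mpoly" assume p: "p \<in> support_ideal V U"
      then have "- p \<in> support_ideal V U" by (rule support_ideal_uminus)
      moreover have "\<ominus>\<^bsub>?R\<^esub> p = - p"
      proof (rule minus_equality)
        show "- p \<oplus>\<^bsub>?R\<^esub> p = \<zero>\<^bsub>?R\<^esub>"
          unfolding poly_ring_ops by (rule left_minus)
        show "p \<in> carrier ?R" "- p \<in> carrier ?R"
          using p \<open>- p \<in> support_ideal V U\<close> unfolding support_ideal_def by blast+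
      qed
      ultimately show "\<ominus>\<^bsub>?R\<^esub> p \<in> support_ideal V U" by simp
    next
      fix p q :: "('v, 'k) mpoly" assume "p \<in> support_ideal V U" "q \<in> support_ideal V U"
      from support_ideal_add[OF this] show "p \<oplus>\<^bsub>?R\<^esub> q \<in> support_ideal V U"
        unfolding poly_ring_ops .
    qed
  next
    fix p q :: "('v, 'k) mpoly" assume "p \<in> support_ideal V U" "q \<in> carrier ?R"
    from support_ideal_times[OF assms this]
    show "q \<otimes>\<^bsub>?R\<^esub> p \<in> support_ideal V U" "p \<otimes>\<^bsub>?R\<^esub> q \<in> support_ideal V U"
      unfolding poly_ring_ops by (simp_all only: mult.commute)
  qed
qed

text \<open>This is the ideal generated by the variables in \<open>A\<close>. Modulo the ideal, each factor may be replaced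
  by its part free of the variables in \<open>A\<close>. The product of two such parts is again free of these
  variables, so if it lies in the ideal then it vanishes, and polynomials have no zero divisors. The order on the
  variables serves to make the latter available, by way of leading monomials.\<close>

lemma primeideal_variables:
  fixes V A :: "'v::linorder set"
  shows "primeideal (support_ideal V (\<lambda>S. S \<inter> A \<noteq> {}) :: ('v, 'k::field) mpoly set) (poly_ring V)"
proof (rule primeidealI)
  let ?R = "poly_ring V :: ('v, 'k) mpoly ring"
  let ?P = "support_ideal V (\<lambda>S. S \<inter> A \<noteq> {}) :: ('v, 'k) mpoly set"
  have mono: "mono (\<lambda>S. S \<inter> A \<noteq> {})" by (rule monoI) auto
  show "ideal ?P ?R" by (rule ideal_support_ideal[OF mono])
  show "cring ?R" by (rule cring_poly_ring)
  have "1 \<in> carrier ?R" "1 \<notin> ?P" by (simp_all add: poly_ring_def support_ideal_def)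
  then show "carrier ?R \<noteq> ?P" by blast
  fix p q assume p: "p \<in> carrier ?R" and q: "q \<in> carrier ?R" and "p \<otimes>\<^bsub>?R\<^esub> q \<in> ?P"
  then have pq: "p * q \<in> ?P" by (simp only: poly_ring_ops)
  have split: "\<exists>f g. h = f + g \<and> f \<in> ?P \<and> g \<in> carrier ?R \<and>
      (\<forall>u\<in>Poly_Mapping.keys g. Poly_Mapping.keys u \<inter> A = {})"
    if h: "h \<in> carrier ?R" for h
  proof -
    let ?s = "\<lambda>u. Poly_Mapping.single u (Poly_Mapping.lookup h u)"
    let ?M = "{u. Poly_Mapping.keys u \<inter> A \<noteq> {}}"
    have keys: "Poly_Mapping.keys (\<Sum>u\<in>B. ?s u) \<subseteq> B" for B
      using keys_sum[of ?s B] by (auto split: if_splits)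
    have "h = (\<Sum>u\<in>Poly_Mapping.keys h \<inter> ?M. ?s u) + (\<Sum>u\<in>Poly_Mapping.keys h - ?M. ?s u)"
      using sum.Int_Diff[OF finite_keys, of ?s h ?M] by (simp add: sum_monomials)
    with keys[of "Poly_Mapping.keys h \<inter> ?M"] keys[of "Poly_Mapping.keys h - ?M"] h show ?thesis
      by (intro exI[of _ "\<Sum>u\<in>Poly_Mapping.keys h \<inter> ?M. ?s u"]
                exI[of _ "\<Sum>u\<in>Poly_Mapping.keys h - ?M. ?s u"] conjI)
         (auto simp: support_ideal_def poly_ring_def)
  qed
  obtain p1 p0 where p01: "p = p1 + p0" "p1 \<in> ?P" "p0 \<in> carrier ?R"
      "\<And>u. u \<in> Poly_Mapping.keys p0 \<Longrightarrow> Poly_Mapping.keys u \<inter> A = {}"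
    using split[OF p] by blast
  obtain q1 q0 where q01: "q = q1 + q0" "q1 \<in> ?P"
      "\<And>u. u \<in> Poly_Mapping.keys q0 \<Longrightarrow> Poly_Mapping.keys u \<inter> A = {}"
    using split[OF q] by blast
  have "p0 * q0 = p * q + (- (p1 * q) + - (q1 * p0))"
    by (simp add: p01(1) q01(1) algebra_simps)
  also have "\<dots> \<in> ?P"
    by (intro support_ideal_add support_ideal_uminus support_ideal_times[OF mono] pq p01 q01 q)
  finally have in_P: "p0 * q0 \<in> ?P" .
  have "Poly_Mapping.keys (p0 * q0) = {}"
  proof (rule ccontr)
    assume "Poly_Mapping.keys (p0 * q0) \<noteq> {}"
    then obtain w where w: "w \<in> Poly_Mapping.keys (p0 * q0)" by blast
    with keys_mult[of p0 q0] obtain u v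
      where "w = u + v" "u \<in> Poly_Mapping.keys p0" "v \<in> Poly_Mapping.keys q0" by blast
    with p01(4) q01(3) have "Poly_Mapping.keys w \<inter> A = {}"
      by (simp add: keys_add_monomial Int_Un_distrib2)
    with in_P w show False by (auto simp: support_ideal_def)
  qed
  then have "p0 = 0 \<or> q0 = 0" by simp
  with p01 q01 show "p \<in> ?P \<or> q \<in> ?P" by auto
qed


section \<open>Facet ideals\<close>

definition squarefree_monomial :: "'v set \<Rightarrow> 'v monomial"
  where "squarefree_monomial F = (\<Sum>x\<in>F. Poly_Mapping.single x 1)"

lemma lookup_squarefree_monomial:
  "finite F \<Longrightarrow> Poly_Mapping.lookup (squarefree_monomial F) x = (if x \<in> F then 1 else 0)"
  by (simp add: squarefree_monomial_def lookup_sum lookup_single when_def)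

lemma keys_squarefree_monomial: "finite F \<Longrightarrow> Poly_Mapping.keys (squarefree_monomial F) = F"
  by (auto simp: in_keys_iff lookup_squarefree_monomial split: if_splits)

lemma mdegree_squarefree_monomial: "finite F \<Longrightarrow> mdegree (squarefree_monomial F) = card F"
  by (simp add: mdegree_def keys_squarefree_monomial lookup_squarefree_monomial)

lemma card_keys_le_mdegree: "card (Poly_Mapping.keys u) \<le> mdegree u"
proof -
  have "(\<Sum>x\<in>Poly_Mapping.keys u. 1) \<le> mdegree u"
    unfolding mdegree_def by (rule sum_mono) (simp add: in_keys_iff Suc_le_eq)
  then show ?thesis by simp
qed

lemma prod_Var:
  "finite F \<Longrightarrow> (\<Prod>x\<in>F. Var x :: ('v, 'k::field) mpoly) = Poly_Mapping.single (squarefree_monomial F) 1"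
  by (induction F rule: finite_induct) (simp_all add: squarefree_monomial_def Var_def mult_single)

text \<open>The generators lie in the right-hand side, which is an ideal. Conversely, each monomial of a member of
  the right-hand side is a multiple of a generator.\<close>

lemma facet_ideal_eq_support_ideal:
  fixes V :: "'v set"
  assumes faces: "\<And>F. F \<in> facets \<Delta> \<Longrightarrow> finite F \<and> F \<subseteq> V"
  shows "facet_ideal V \<Delta> = (support_ideal V (\<lambda>S. \<exists>F\<in>facets \<Delta>. F \<subseteq> S) :: ('v, 'k::field) mpoly set)"
    (is "_ = ?J")
proof
  let ?R = "poly_ring V :: ('v, 'k) mpoly ring"
  let ?G = "{(\<Prod>x\<in>F. Var x) | F. F \<in> facets \<Delta>} :: ('v, 'k) mpoly set"
  interpret cring ?R by (rule cring_poly_ring)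
  have "?G \<subseteq> ?J"
    using faces by (force simp: prod_Var support_ideal_def poly_ring_def keys_squarefree_monomial)
  moreover have "mono (\<lambda>S. \<exists>F\<in>facets \<Delta>. F \<subseteq> S)" by (rule monoI) auto
  ultimately show "facet_ideal V \<Delta> \<subseteq> ?J"
    unfolding facet_ideal_def by (intro genideal_minimal ideal_support_ideal)
  have G: "?G \<subseteq> carrier ?R"
    using \<open>?G \<subseteq> ?J\<close> by (auto simp: support_ideal_def)
  interpret I: ideal "facet_ideal V \<Delta> :: ('v, 'k) mpoly set" ?R
    unfolding facet_ideal_def by (rule genideal_ideal[OF G])
  show "?J \<subseteq> facet_ideal V \<Delta>"
  proof
    fix p :: "('v, 'k) mpoly" assume p: "p \<in> ?J"
    have monomial: "Poly_Mapping.single u c \<in> facet_ideal V \<Delta>"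
      if u: "u \<in> Poly_Mapping.keys p" for u and c :: 'k
    proof -
      obtain F where F: "F \<in> facets \<Delta>" "F \<subseteq> Poly_Mapping.keys u"
        using p u by (auto simp: support_ideal_def)
      have finF: "finite F" using faces F(1) by blast
      have "(\<Prod>x\<in>F. Var x) \<in> ?G" using F(1) by blast
      then have gen: "(\<Prod>x\<in>F. Var x) \<in> (facet_ideal V \<Delta> :: ('v, 'k) mpoly set)"
        unfolding facet_ideal_def using genideal_self[OF G] by blast
      have u_eq: "(u - squarefree_monomial F) + squarefree_monomial F = u"
        using F(2) finF
        by (intro poly_mapping_eqI)
           (auto simp: lookup_add lookup_minus lookup_squarefree_monomial in_keys_iff subset_iff)
      have "Poly_Mapping.keys (u - squarefree_monomial F) \<subseteq> V"
        using keys_diff[of u "squarefree_monomial F"] p u finF F(2)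
        by (fastforce simp: support_ideal_def poly_ring_def keys_squarefree_monomial)
      then have "Poly_Mapping.single (u - squarefree_monomial F) c \<in> carrier ?R"
        by (simp add: poly_ring_def)
      from I.I_l_closed[OF gen this] show ?thesis
        unfolding poly_ring_ops by (simp only: prod_Var[OF finF] mult_single u_eq mult_1_right)
    qed
    have "(\<Sum>u\<in>B. Poly_Mapping.single u (Poly_Mapping.lookup p u)) \<in> facet_ideal V \<Delta>"
      if "B \<subseteq> Poly_Mapping.keys p" for B
      using finite_subset[OF that finite_keys] that
    proof (induction B rule: finite_induct)
      case empty
      then show ?case using I.zero_closed unfolding poly_ring_ops by simp
    next
      case (insert u B)
      then show ?case
        using I.a_closed[OF monomial[of u "Poly_Mapping.lookup p u"]]
        unfolding poly_ring_ops by simp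
    qed
    from this[OF order_refl] show "p \<in> facet_ideal V \<Delta>"
      by (simp add: sum_monomials)
  qed
qed

lemma Var_in_prime_of_prod:
  fixes P :: "('v, 'k::field) mpoly set"
  assumes P: "primeideal P (poly_ring V)" and F: "finite F" "F \<subseteq> V" and "(\<Prod>x\<in>F. Var x) \<in> P"
  shows "\<exists>x\<in>F. Var x \<in> P"
  using F assms(4)
proof (induction F rule: finite_induct)
  case empty
  interpret primeideal P "poly_ring V" by (rule P)
  have "\<one>\<^bsub>poly_ring V\<^esub> \<in> P" using empty by (simp add: poly_ring_ops)
  then show ?case using one_imp_carrier I_notcarr by simp
next
  case (insert x F)
  interpret primeideal P "poly_ring V" by (rule P)
  have "(\<Prod>y\<in>F. Var y :: ('v, 'k) mpoly) \<in> carrier (poly_ring V)"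
    using insert.hyps insert.prems by (simp add: prod_Var poly_ring_def keys_squarefree_monomial)
  moreover have "Var x \<in> carrier (poly_ring V :: ('v, 'k) mpoly ring)"
    using insert.prems by (simp add: Var_in_carrier)
  moreover have "Var x \<otimes>\<^bsub>poly_ring V\<^esub> (\<Prod>y\<in>F. Var y) \<in> P"
    using insert.prems insert.hyps unfolding poly_ring_ops by simp
  ultimately show ?case using I_prime insert by blast
qed


section \<open>The chessboard complex\<close>

text \<open>As there are at least as many columns as rows, a face that leaves a row empty also leaves
  a column empty and is not maximal. Hence the facets are the placements with a rook in each row.\<close>

lemma facet_subset_iff_has_placement:
  assumes "m \<le> n"
  shows "(\<exists>F\<in>facets (chessboard_complex m n). F \<subseteq> S) \<longleftrightarrow> has_placement {1..m} (S \<inter> squares m n)"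
proof
  assume "\<exists>F\<in>facets (chessboard_complex m n). F \<subseteq> S"
  then obtain F where F: "F \<in> facets (chessboard_complex m n)" and FS: "F \<subseteq> S" by blast
  have sq: "F \<subseteq> squares m n"
    and rook: "\<And>x y. x \<in> F \<Longrightarrow> y \<in> F \<Longrightarrow> x \<noteq> y \<Longrightarrow> fst x \<noteq> fst y \<and> snd x \<noteq> snd y"
    and max: "\<And>G. G \<in> chessboard_complex m n \<Longrightarrow> F \<subseteq> G \<Longrightarrow> G = F"
    using F by (auto simp: facets_def chessboard_complex_def)
  have finF: "finite F" by (rule finite_subset[OF sq]) (simp add: squares_def)
  have "\<exists>j. (i, j) \<in> F" if i: "i \<in> {1..m}" for i
  proof (rule ccontr)
    assume no: "\<nexists>j. (i, j) \<in> F"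
    have "card (snd ` F) = card F" "card (fst ` F) = card F"
      using rook by (auto intro!: card_image inj_onI)
    moreover have "i \<notin> fst ` F" using no by auto
    with sq i have "fst ` F \<subset> {1..m}" unfolding squares_def by fastforce
    then have "card (fst ` F) < card {1..m}" by (intro psubset_card_mono) auto
    ultimately have "card (snd ` F) < card {1..n}" using assms by simp
    then have "\<not> {1..n} \<subseteq> snd ` F"
      using card_mono[of "snd ` F" "{1..n}"] finF by auto
    then obtain j where j: "j \<in> {1..n}" "j \<notin> snd ` F" by blast
    have new: "fst x \<noteq> i \<and> snd x \<noteq> j" if "x \<in> F" for x
      using no j(2) that by (cases x) force
    have "insert (i, j) F \<in> chessboard_complex m n"
      unfolding chessboard_complex_def
    proof (intro CollectI conjI ballI impI)
      show "insert (i, j) F \<subseteq> squares m n" using sq i j(1) by (simp add: squares_def)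
    next
      fix x y assume "x \<in> insert (i, j) F" "y \<in> insert (i, j) F" "x \<noteq> y"
      then have "fst x \<noteq> fst y \<and> snd x \<noteq> snd y"
        using rook[of x y] new[of x] new[of y] by auto
      then show "fst x \<noteq> fst y" "snd x \<noteq> snd y" by auto
    qed
    from max[OF this] no show False by blast
  qed
  then obtain \<sigma> where \<sigma>: "\<And>i. i \<in> {1..m} \<Longrightarrow> (i, \<sigma> i) \<in> F" by metis
  moreover have "inj_on \<sigma> {1..m}"
  proof (rule inj_onI)
    fix i k assume "i \<in> {1..m}" "k \<in> {1..m}" "\<sigma> i = \<sigma> k"
    then show "i = k" using rook[OF \<sigma>[of i] \<sigma>[of k]] by auto
  qed
  ultimately show "has_placement {1..m} (S \<inter> squares m n)"
    using FS sq unfolding has_placement_def by blast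
next
  assume "has_placement {1..m} (S \<inter> squares m n)"
  then obtain \<sigma> where inj: "inj_on \<sigma> {1..m}" and \<sigma>: "\<And>i. i \<in> {1..m} \<Longrightarrow> (i, \<sigma> i) \<in> S \<inter> squares m n"
    unfolding has_placement_def by blast
  let ?F = "(\<lambda>i. (i, \<sigma> i)) ` {1..m}"
  have "?F \<in> chessboard_complex m n"
    unfolding chessboard_complex_def
  proof (intro CollectI conjI ballI impI)
    show "?F \<subseteq> squares m n" using \<sigma> by blast
  next
    fix x y assume "x \<in> ?F" "y \<in> ?F" "x \<noteq> y"
    then obtain i k where "x = (i, \<sigma> i)" "y = (k, \<sigma> k)" "i \<in> {1..m}" "k \<in> {1..m}" "i \<noteq> k"
      by blast
    then show "fst x \<noteq> fst y" "snd x \<noteq> snd y"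
      using inj_onD[OF inj, of i k] by auto
  qed
  moreover have "G = ?F" if G: "G \<in> chessboard_complex m n" "?F \<subseteq> G" for G
  proof -
    have "(i, j) \<in> ?F" if ij: "(i, j) \<in> G" for i j
    proof -
      have i: "i \<in> {1..m}" using G ij by (auto simp: chessboard_complex_def squares_def)
      then have "(i, \<sigma> i) \<in> G" using G(2) by blast
      with G(1) ij have "(i, j) \<noteq> (i, \<sigma> i) \<Longrightarrow> fst (i, j) \<noteq> fst (i, \<sigma> i)"
        unfolding chessboard_complex_def by blast
      then have "j = \<sigma> i" by auto
      with i show ?thesis by blast
    qed
    with G(2) show ?thesis by auto
  qed
  ultimately have "?F \<in> facets (chessboard_complex m n)" unfolding facets_def by blast
  moreover have "?F \<subseteq> S" using \<sigma> by blast
  ultimately show "\<exists>F\<in>facets (chessboard_complex m n). F \<subseteq> S" by (rule rev_bexI)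
qed

lemma facet_chessboard_finite:
  assumes "F \<in> facets (chessboard_complex m n)"
  shows "finite F \<and> F \<subseteq> squares m n"
proof -
  have "F \<subseteq> squares m n"
    using assms unfolding facets_def chessboard_complex_def by blast
  moreover have "finite (squares m n)" by (simp add: squares_def)
  ultimately show ?thesis using finite_subset by blast
qed

lemma facet_ideal_chessboard:
  assumes "m \<le> n"
  shows "(facet_ideal (squares m n) (chessboard_complex m n) :: (nat \<times> nat, 'k::field) mpoly set) =
    support_ideal (squares m n) (\<lambda>S. has_placement {1..m} (S \<inter> squares m n))"
  unfolding facet_subset_iff_has_placement[OF assms, symmetric]
  by (rule facet_ideal_eq_support_ideal) (rule facet_chessboard_finite)


section \<open>The v-number\<close>

text \<open>Some monomial of \<open>f\<close> is outside \<open>I\<close>, as otherwise the colon ideal would be the whole ring. Its support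
  and the set of variables in \<open>P\<close> satisfy the hypotheses of \<open>critical_set_card\<close>, and the size
  of the support bounds the degree from below.\<close>

lemma chessboard_prime_colon_degree_ge:
  fixes f :: "(nat \<times> nat, 'k::field) mpoly"
  assumes mn: "m \<le> n"
    and P: "primeideal P (poly_ring (squares m n))"
    and f: "f \<in> homogeneous_component (squares m n) d"
    and colon: "colon (poly_ring (squares m n)) (facet_ideal (squares m n) (chessboard_complex m n)) f = P"
  shows "2 * m - 2 \<le> d"
proof -
  let ?V = "squares m n" and ?I = "facet_ideal (squares m n) (chessboard_complex m n) :: (nat \<times> nat, 'k) mpoly set"
  let ?R = "poly_ring ?V :: (nat \<times> nat, 'k) mpoly ring"
  let ?U = "\<lambda>S. has_placement {1..m} (S \<inter> ?V)"
  note I = facet_ideal_chessboard[OF mn, where 'k = 'k]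
  interpret P: primeideal P ?R by (rule P)
  have mono: "mono ?U" by (rule monoI) (auto intro: has_placement_mono)
  have fc: "f \<in> carrier ?R" using f by (simp add: homogeneous_component_def)
  have colonD: "g * f \<in> ?I" if "g \<in> P" for g
    using that unfolding colon[symmetric] colon_def poly_ring_ops by blast
  have "f \<notin> ?I"
  proof
    assume "f \<in> ?I"
    then have "\<one>\<^bsub>?R\<^esub> \<otimes>\<^bsub>?R\<^esub> f \<in> ?I" by (simp add: poly_ring_ops)
    then have "\<one>\<^bsub>?R\<^esub> \<in> P" unfolding colon[symmetric] colon_def using P.one_closed by blast
    then show False using P.one_imp_carrier P.I_notcarr by simp
  qed
  then obtain u where u: "u \<in> Poly_Mapping.keys f" "\<not> ?U (Poly_Mapping.keys u)"
    using fc unfolding I support_ideal_def by blast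
  have uV: "Poly_Mapping.keys u \<subseteq> ?V" using fc u(1) by (auto simp: poly_ring_def)
  define C where "C = {v \<in> ?V. Var v \<in> P}"
  have "has_placement {1..m} (insert v (Poly_Mapping.keys u))" if v: "v \<in> C" for v
  proof -
    have "Var v * f \<in> ?I" using v by (intro colonD) (simp add: C_def)
    moreover have "Poly_Mapping.single v 1 + u \<in> Poly_Mapping.keys (Var v * f)"
      unfolding Var_def using u(1) by (subst keys_times_monomial) auto
    ultimately have "?U (Poly_Mapping.keys (Poly_Mapping.single v 1 + u))"
      unfolding I support_ideal_def by blast
    then show ?thesis
      by (rule has_placement_mono) (auto simp: keys_add_monomial)
  qed
  moreover have "\<not> has_placement {1..m} ({1..m} \<times> {1..n} - C)"
  proof
    assume "has_placement {1..m} ({1..m} \<times> {1..n} - C)"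
    then have "has_placement {1..m} ((?V - C) \<inter> ?V)"
      by (rule has_placement_mono) (auto simp: squares_def)
    then obtain F where F: "F \<in> facets (chessboard_complex m n)" "F \<subseteq> ?V - C"
      using facet_subset_iff_has_placement[OF mn, of "?V - C"] by blast
    have finF: "finite F" "F \<subseteq> ?V" using facet_chessboard_finite[OF F(1)] by auto
    have prod: "(\<Prod>x\<in>F. Var x :: (nat \<times> nat, 'k) mpoly) \<in> ?I"
      unfolding I using finF F(1) facet_subset_iff_has_placement[OF mn, of F]
      by (auto simp: prod_Var support_ideal_def poly_ring_def keys_squarefree_monomial)
    then have "(\<Prod>x\<in>F. Var x) * f \<in> ?I"
      unfolding I by (rule support_ideal_times[OF mono _ fc])
    with prod have "(\<Prod>x\<in>F. Var x) \<in> P"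
      unfolding colon[symmetric] I colon_def poly_ring_ops by (simp add: support_ideal_def)
    then obtain x where "x \<in> F" "Var x \<in> P"
      using Var_in_prime_of_prod[OF P finF] by blast
    with F(2) show False by (auto simp: C_def)
  qed
  ultimately have "2 * card {1..m} \<le> card (Poly_Mapping.keys u) + 2"
    using mn uV u(2)
    by (intro critical_set_card[where L = "{1..n}" and C = C])
       (auto simp: squares_def Int_absorb2)
  moreover have "mdegree u = d" using f u(1) by (auto simp: homogeneous_component_def)
  ultimately show ?thesis using card_keys_le_mdegree[of u] by simp
qed

text \<open>The witness is the squarefree monomial of a staircase with two squares in each row but the first.
  In it the rows \<open>2, \<dots>, m\<close> and the columns \<open>1, \<dots>, m\<close> form a path, and removing a column
  from the path leaves a perfect matching of the rows: the rows up to the removed column shift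
  left, the others stay on the diagonal.\<close>

lemma chessboard_colon_first_row:
  fixes m n :: nat
  assumes "1 \<le> m" "m \<le> n"
  obtains f :: "(nat \<times> nat, 'k::field) mpoly"
  where "f \<in> homogeneous_component (squares m n) (2 * m - 2)"
    and "colon (poly_ring (squares m n)) (facet_ideal (squares m n) (chessboard_complex m n)) f =
      support_ideal (squares m n) (\<lambda>S. S \<inter> {1} \<times> {1..n} \<noteq> {})"
proof -
  let ?V = "squares m n"
  define T :: "(nat \<times> nat) set" where "T = (\<lambda>i. (i, i - 1)) ` {2..m} \<union> (\<lambda>i. (i, i)) ` {2..m}"
  define f :: "(nat \<times> nat, 'k) mpoly" where "f = Poly_Mapping.single (squarefree_monomial T) 1"
  have finT: "finite T" by (simp add: T_def)
  have TV: "T \<subseteq> ?V" using assms by (auto simp: T_def squares_def)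
  have "card T = card ((\<lambda>i::nat. (i, i - 1)) ` {2..m}) + card ((\<lambda>i::nat. (i, i)) ` {2..m})"
    unfolding T_def by (intro card_Un_disjoint) auto
  also have "\<dots> = 2 * m - 2"
    using assms by (simp add: card_image inj_on_def)
  finally have cardT: "card T = 2 * m - 2" .
  have f: "f \<in> homogeneous_component ?V (2 * m - 2)"
    using TV by (simp add: f_def homogeneous_component_def poly_ring_def keys_squarefree_monomial[OF finT]
        mdegree_squarefree_monomial[OF finT] cardT)
  have fc: "f \<in> carrier (poly_ring ?V)" using f by (simp add: homogeneous_component_def)
  have placement_iff: "has_placement {1..m} ((T \<union> S) \<inter> ?V) \<longleftrightarrow> S \<inter> {1} \<times> {1..n} \<noteq> {}"
    if S: "S \<subseteq> ?V" for S
  proof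
    assume "has_placement {1..m} ((T \<union> S) \<inter> ?V)"
    then obtain \<sigma> where \<sigma>: "\<forall>i\<in>{1..m}. (i, \<sigma> i) \<in> (T \<union> S) \<inter> ?V"
      unfolding has_placement_def by blast
    have "(1, \<sigma> 1) \<in> (T \<union> S) \<inter> ?V" by (rule bspec[OF \<sigma>]) (use assms(1) in simp)
    then show "S \<inter> {1} \<times> {1..n} \<noteq> {}" by (auto simp: T_def squares_def)
  next
    assume "S \<inter> {1} \<times> {1..n} \<noteq> {}"
    then obtain j where j: "(1, j) \<in> S" "1 \<le> j" "j \<le> n" by auto
    define \<sigma> where "\<sigma> i = (if i = 1 then j else if i \<le> j then i - 1 else i)" for i :: nat
    have "inj_on \<sigma> {1..m}"
      using j by (auto simp: inj_on_def \<sigma>_def)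
    moreover have "(i, \<sigma> i) \<in> (T \<union> S) \<inter> ?V" if "i \<in> {1..m}" for i
      using that j assms(2) by (auto simp: \<sigma>_def T_def image_iff squares_def)
    ultimately show "has_placement {1..m} ((T \<union> S) \<inter> ?V)"
      unfolding has_placement_def by blast
  qed
  have "colon (poly_ring ?V) (facet_ideal ?V (chessboard_complex m n)) f =
      support_ideal ?V (\<lambda>S. S \<inter> {1} \<times> {1..n} \<noteq> {})"
  proof -
    have "g * f \<in> support_ideal ?V (\<lambda>S. has_placement {1..m} (S \<inter> ?V)) \<longleftrightarrow>
        (\<forall>u\<in>Poly_Mapping.keys g. Poly_Mapping.keys u \<inter> {1} \<times> {1..n} \<noteq> {})"
      if g: "g \<in> carrier (poly_ring ?V)" for g :: "(nat \<times> nat, 'k) mpoly"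
    proof -
      have "g * f \<in> carrier (poly_ring ?V)"
        using g fc by (rule times_in_carrier)
      moreover have "Poly_Mapping.keys (g * f) = (+) (squarefree_monomial T) ` Poly_Mapping.keys g"
        unfolding f_def by (subst mult.commute) (rule keys_times_monomial, simp)
      ultimately have "g * f \<in> support_ideal ?V (\<lambda>S. has_placement {1..m} (S \<inter> ?V)) \<longleftrightarrow>
          (\<forall>u\<in>Poly_Mapping.keys g. has_placement {1..m} ((T \<union> Poly_Mapping.keys u) \<inter> ?V))"
        by (simp add: support_ideal_def keys_add_monomial keys_squarefree_monomial[OF finT])
      also have "\<dots> \<longleftrightarrow> (\<forall>u\<in>Poly_Mapping.keys g. Poly_Mapping.keys u \<inter> {1} \<times> {1..n} \<noteq> {})"
        using g by (intro ball_cong placement_iff) (auto simp: poly_ring_def)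
      finally show ?thesis .
    qed
    then show ?thesis
      unfolding facet_ideal_chessboard[OF assms(2)] colon_def
        support_ideal_def[of _ "\<lambda>S. S \<inter> {1} \<times> {1..n} \<noteq> {}"]
      by (intro Collect_cong conj_cong refl) (simp add: poly_ring_def)
  qed
  with f show thesis by (rule that)
qed

theorem theorem1p4:
  fixes m n :: nat
  assumes "1 \<le> m" and "m \<le> n"
  shows "v_number (squares m n)
           (facet_ideal (squares m n) (chessboard_complex m n) :: (nat \<times> nat, 'k::field) mpoly set)
         = enat (2 * m - 2)"
proof (rule antisym)
  let ?V = "squares m n"
  let ?R = "poly_ring ?V :: (nat \<times> nat, 'k) mpoly ring"
  let ?I = "facet_ideal ?V (chessboard_complex m n) :: (nat \<times> nat, 'k) mpoly set"
  let ?P = "support_ideal ?V (\<lambda>S. S \<inter> {1} \<times> {1..n} \<noteq> {}) :: (nat \<times> nat, 'k) mpoly set"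
  obtain f where f: "f \<in> homogeneous_component ?V (2 * m - 2)" "colon ?R ?I f = ?P"
    using chessboard_colon_first_row[OF assms] by metis
  have "?P \<in> Ass ?R ?I"
    using f primeideal_variables unfolding Ass_def homogeneous_component_def by blast
  moreover have "v_local ?V ?I ?P \<le> enat (2 * m - 2)"
    unfolding v_local_def using f by (intro Inf_lower) blast
  ultimately show "v_number ?V ?I \<le> enat (2 * m - 2)"
    unfolding v_number_def by (rule INF_lower2)
  show "enat (2 * m - 2) \<le> v_number ?V ?I"
    unfolding v_number_def v_local_def
  proof (intro INF_greatest Inf_greatest)
    fix P k
    assume "P \<in> Ass ?R ?I" "k \<in> {enat d |d. \<exists>f\<in>homogeneous_component ?V d. colon ?R ?I f = P}"
    then show "enat (2 * m - 2) \<le> k"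
      using chessboard_prime_colon_degree_ge[OF assms(2)] by (fastforce simp: Ass_def)
  qed
qed

end
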